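(* Let $D\ge1$, let $N_1,\dots,N_D$ and $M$ be positive integers, let $\Omega:=\prod_{d=1}^D\mathbb{Z}_{N_d}$, and let $R_1,\dots,R_M:\Omega\to\mathbb{R}$ be any functions. Let $A$ be a linear operator from $\ell(\Omega)=\{f\mid f:\Omega\to\mathbb{R}\}$ into itself. If $A$ is self-adjoint, then for any initial $\psi_0:\Omega\to\{1,\dots,M\}$, the cycle length $K$ of the iteration $$\psi_i(n)=\min\Bigl(\operatorname*{argmax}_{1\le m\le M}\bigl[(A\mu_m^{(i-1)})(n)+R_m(n)\bigr]\Bigr),\qquad n\in\Omega,\ i\ge1,$$ where $\mu_m^{(i-1)}(n)=1$ if $\psi_{i-1}(n)=m$ and $\mu_m^{(i-1)}(n)=0$ otherwise, is either $1$ or $2$.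
   Context: Self-adjointness is with respect to the standard real inner product $\langle f,h\rangle=\sum_{n\in\Omega}f(n)h(n)$ on $\ell(\Omega)$. The expression $\operatorname{argmax}$ denotes the set of all maximizing $m$, so ties are broken by choosing the smallest maximizing $m$. Since there are only finitely many functions $\Omega\to\{1,\dots,M\}$ and the iteration is deterministic, the sequence $\{\psi_i\}_{i=0}^\infty$ is eventually periodic: take the minimal indices $i_0\ge0$ and $K>0$ such that $\psi_{i_0+K}=\psi_{i_0}$; then $\psi_{i+K}=\psi_i$ for all $i\ge i_0$. The number $K$ (the minimal eventual period of the sequence started at $\psi_0$) is called the cycle length. *)

theory Defs
  imports Complex_Main "HOL-Algebra.Product_Groups"
begin

(* Points are extensional functions on {1..D}; each factor is the cyclic group with carrier
   {0..<N d} when N d > 0 (the library takes integer_mod_group 0 to be the integers). *)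
definition torus :: "nat \<Rightarrow> (nat \<Rightarrow> nat) \<Rightarrow> (nat \<Rightarrow> int) set" where
  "torus D N = carrier (product_group {1..D} (\<lambda>d. integer_mod_group (N d)))"

(* Real functions on S are represented extensionally (with the value undefined off S), so that
   equality in HOL is equality of functions on S. *)
definition ell :: "'a set \<Rightarrow> ('a \<Rightarrow> real) set" where
  "ell S = S \<rightarrow>\<^sub>E UNIV"

definition linear_operator :: "'a set \<Rightarrow> (('a \<Rightarrow> real) \<Rightarrow> ('a \<Rightarrow> real)) \<Rightarrow> bool" where
  "linear_operator S A \<longleftrightarrow>
     A \<in> ell S \<rightarrow> ell S \<and>
     (\<forall>f\<in>ell S. \<forall>h\<in>ell S. A (\<lambda>n\<in>S. f n + h n) = (\<lambda>n\<in>S. A f n + A h n)) \<and>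
     (\<forall>c. \<forall>f\<in>ell S. A (\<lambda>n\<in>S. c * f n) = (\<lambda>n\<in>S. c * A f n))"

definition ell_inner :: "'a set \<Rightarrow> ('a \<Rightarrow> real) \<Rightarrow> ('a \<Rightarrow> real) \<Rightarrow> real" where
  "ell_inner S f h = (\<Sum>n\<in>S. f n * h n)"

definition self_adjoint :: "'a set \<Rightarrow> (('a \<Rightarrow> real) \<Rightarrow> ('a \<Rightarrow> real)) \<Rightarrow> bool" where
  "self_adjoint S A \<longleftrightarrow>
     (\<forall>f\<in>ell S. \<forall>h\<in>ell S. ell_inner S (A f) h = ell_inner S f (A h))"

definition label_indicator :: "'a set \<Rightarrow> ('a \<Rightarrow> nat) \<Rightarrow> nat \<Rightarrow> 'a \<Rightarrow> real" where
  "label_indicator S \<psi> m = (\<lambda>n\<in>S. if \<psi> n = m then 1 else 0)"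

definition argmax_set :: "('b \<Rightarrow> real) \<Rightarrow> 'b set \<Rightarrow> 'b set" where
  "argmax_set g B = {m. is_arg_max g (\<lambda>m. m \<in> B) m}"

definition update ::
  "'a set \<Rightarrow> nat \<Rightarrow> (('a \<Rightarrow> real) \<Rightarrow> ('a \<Rightarrow> real)) \<Rightarrow> (nat \<Rightarrow> 'a \<Rightarrow> real) \<Rightarrow> ('a \<Rightarrow> nat) \<Rightarrow> ('a \<Rightarrow> nat)"
  where
  "update S M A R \<psi> =
     (\<lambda>n\<in>S. Min (argmax_set (\<lambda>m. A (label_indicator S \<psi> m) n + R m n) {1..M}))"

definition iteration ::
  "'a set \<Rightarrow> nat \<Rightarrow> (('a \<Rightarrow> real) \<Rightarrow> ('a \<Rightarrow> real)) \<Rightarrow> (nat \<Rightarrow> 'a \<Rightarrow> real) \<Rightarrow> ('a \<Rightarrow> nat) \<Rightarrow> nat \<Rightarrow> ('a \<Rightarrow> nat)"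
  where
  "iteration S M A R \<psi>0 i = (update S M A R ^^ i) \<psi>0"

(* The two LEAST operators below are meaningful only for sequences in which some value recurs;
   this holds for the iteration above when S is finite. *)
definition cycle_start :: "(nat \<Rightarrow> 'b) \<Rightarrow> nat" where
  "cycle_start s = (LEAST i. \<exists>K>0. s (i + K) = s i)"

definition cycle_length :: "(nat \<Rightarrow> 'b) \<Rightarrow> nat" where
  "cycle_length s = (LEAST K. K > 0 \<and> s (cycle_start s + K) = s (cycle_start s))"

end

theory Submission
  imports Defs
begin

text \<open>
  Think of two consecutive labelings as the two arguments of the interaction energy
  \<open>J(\<phi>, \<psi>) = (\<Sum>m. \<langle>\<mu>\<^sub>m(\<phi>), A \<mu>\<^sub>m(\<psi>)\<rangle>) + (\<Sum>n. R\<^bsub>\<phi>(n)\<^esub>(n)) + (\<Sum>n. R\<^bsub>\<psi>(n)\<^esub>(n))\<close>,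
  where the \<open>\<mu>\<^sub>m\<close> are the label indicators. Self-adjointness makes \<open>J\<close> symmetric
  (\<open>energy_commute\<close>). For fixed \<open>\<psi>\<close> the energy decouples, up to a constant, into independent
  terms, one for each site, and the update maximizes each of these terms; thus the update of \<open>\<psi>\<close>
  maximizes \<open>J(\<cdot>, \<psi>)\<close>, and because ties go to the smallest label it is the pointwise least
  maximizer (\<open>energy_le_energy_update\<close>, \<open>update_le_if_energy_eq\<close>).

  Along an orbit this gives
  \<open>J(\<psi>\<^sub>i\<^sub>+\<^sub>2, \<psi>\<^sub>i\<^sub>+\<^sub>1) \<ge> J(\<psi>\<^sub>i, \<psi>\<^sub>i\<^sub>+\<^sub>1) = J(\<psi>\<^sub>i\<^sub>+\<^sub>1, \<psi>\<^sub>i)\<close>, so the energy of consecutive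
  labelings never decreases, and on a cycle it must be constant. Then \<open>\<psi>\<^sub>i\<close> is itself a
  maximizer of \<open>J(\<cdot>, \<psi>\<^sub>i\<^sub>+\<^sub>1)\<close>, hence \<open>\<psi>\<^sub>i\<^sub>+\<^sub>2 \<le> \<psi>\<^sub>i\<close> pointwise. A periodic sequence whose
  double steps all descend has equality in each of them, so \<open>\<psi>\<^sub>i\<^sub>+\<^sub>2 = \<psi>\<^sub>i\<close> on the cycle
  (\<open>periodic_point_of_symmetric_ascent\<close>).
\<close>

section \<open>Periodic orbits of least-maximizer dynamics\<close>

text \<open>
  The potential along the orbit is \<open>J (f y) y\<close>. Passing from \<open>y\<close> to \<open>f y\<close> compares
  \<open>J (f (f y)) (f y)\<close> with \<open>J y (f y)\<close>, which by symmetry is the previous value. Periodicity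
  turns this ascent into equality, and the tie-breaking hypothesis then makes the even steps of
  the orbit descend in the order, which periodicity again forbids unless they stand still.
\<close>

lemma periodic_point_of_symmetric_ascent:
  fixes f :: "'b::order \<Rightarrow> 'b" and J :: "'b \<Rightarrow> 'b \<Rightarrow> 'c::order"
  assumes maps: "\<And>y. y \<in> X \<Longrightarrow> f y \<in> X"
    and sym: "\<And>y z. y \<in> X \<Longrightarrow> z \<in> X \<Longrightarrow> J y z = J z y"
    and ascent: "\<And>y z. y \<in> X \<Longrightarrow> z \<in> X \<Longrightarrow> J y z \<le> J (f z) z"
    and tie: "\<And>y z. y \<in> X \<Longrightarrow> z \<in> X \<Longrightarrow> J y z = J (f z) z \<Longrightarrow> f z \<le> y"
    and x: "x \<in> X" and p: "p > 0" "(f ^^ p) x = x"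
  shows "f (f x) = x"
proof -
  define s where "s i = (f ^^ i) x" for i
  define E where "E i = J (s (Suc i)) (s i)" for i
  have s_Suc: "s (Suc i) = f (s i)" for i
    by (simp add: s_def)
  have s_in: "s i \<in> X" for i
    by (induction i) (use x maps in \<open>auto simp: s_def\<close>)
  have s_period: "s (i + p) = s i" for i
    using p(2) by (simp add: s_def funpow_add)
  have E_sym: "E i = J (s i) (s (Suc i))" for i
    using sym s_in by (simp add: E_def)
  have E_mono: "E i \<le> E j" if "i \<le> j" for i j
    using that
  proof (rule lift_Suc_mono_le[rotated])
    fix k
    show "E k \<le> E (Suc k)"
      unfolding E_sym[of k] using ascent[OF s_in s_in, of k "Suc k"] by (simp add: E_def s_Suc)
  qed
  have E_const: "E (Suc i) = E i" for i
  proof (rule antisym)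
    have "E (Suc i) \<le> E (i + p)"
      using p(1) by (intro E_mono) simp
    also have "E (i + p) = E i"
      using s_period[of i] s_period[of "Suc i"] by (simp add: E_def)
    finally show "E (Suc i) \<le> E i" .
  qed (simp add: E_mono)
  have descend: "s (i + 2) \<le> s i" for i
    using tie[OF s_in s_in, of i "Suc i"] E_const[of i] E_sym[of i]
    by (simp add: E_def s_Suc)
  have even_descend: "s (2 + 2 * k) \<le> s 2" for k
  proof (induction k)
    case (Suc k)
    then show ?case
      using descend[of "2 + 2 * k"] by (simp add: algebra_simps)
  qed simp
  \<comment> \<open>After \<open>p\<close> double steps, i.e. two full periods, the orbit is back at its start.\<close>
  have "s 0 = s (2 * p)"
    using s_period[of 0] s_period[of p] by (simp add: mult_2)
  also have "\<dots> \<le> s 2"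
    using even_descend[of "p - 1"] p(1) by (cases p) auto
  finally have "s 2 = s 0"
    using descend[of 0] by (simp only: add_0 order.eq_iff)
  then show ?thesis
    by (simp add: s_def numeral_2_eq_2)
qed

text \<open>
  Pigeonhole supplies a recurrence, so the cycle start is a genuinely recurrent index and every
  return time to it bounds the cycle length from above.
\<close>

lemma cycle_length_funpow_le:
  fixes f :: "'b \<Rightarrow> 'b"
  assumes "finite X" and maps: "\<And>y. y \<in> X \<Longrightarrow> f y \<in> X" and x: "x \<in> X"
    and return: "\<And>y p. y \<in> X \<Longrightarrow> p > 0 \<Longrightarrow> (f ^^ p) y = y \<Longrightarrow> (f ^^ q) y = y"
    and q: "q > 0"
  shows "cycle_length (\<lambda>i. (f ^^ i) x) \<in> {1..q}"
proof -
  let ?s = "\<lambda>i. (f ^^ i) x"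
  have s_in: "?s i \<in> X" for i
    by (induction i) (use x maps in auto)
  then have "finite (range ?s)"
    using \<open>finite X\<close> by (meson finite_subset image_subsetI)
  then have "\<not> inj ?s"
    using finite_imageD infinite_UNIV_nat by blast
  then obtain i j where "i < j" "?s i = ?s j"
    unfolding inj_def by (metis linorder_neqE_nat)
  then have "\<exists>K>0. ?s (i + K) = ?s i"
    by (intro exI[of _ "j - i"]) simp
  then have "\<exists>K>0. ?s (cycle_start ?s + K) = ?s (cycle_start ?s)"
    unfolding cycle_start_def by (rule LeastI)
  then obtain p where p: "p > 0" "?s (cycle_start ?s + p) = ?s (cycle_start ?s)"
    by blast
  have shift: "?s (i + k) = (f ^^ k) (?s i)" for i k
    by (simp add: funpow_add add.commute[of i])
  have recur: "q > 0 \<and> ?s (cycle_start ?s + q) = ?s (cycle_start ?s)"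
    using return[OF s_in p(1)] p(2) q unfolding shift by blast
  have "cycle_length ?s \<le> q"
    unfolding cycle_length_def using recur by (rule Least_le)
  moreover have "cycle_length ?s > 0 \<and> ?s (cycle_start ?s + cycle_length ?s) = ?s (cycle_start ?s)"
    unfolding cycle_length_def using recur by (rule LeastI)
  ultimately show ?thesis
    by simp
qed

section \<open>The interaction energy of two labelings\<close>

definition energy ::
  "'a set \<Rightarrow> (('a \<Rightarrow> real) \<Rightarrow> ('a \<Rightarrow> real)) \<Rightarrow> (nat \<Rightarrow> 'a \<Rightarrow> real) \<Rightarrow> ('a \<Rightarrow> nat) \<Rightarrow> ('a \<Rightarrow> nat) \<Rightarrow> real"
  where
  "energy S A R \<phi> \<psi> =
     (\<Sum>n\<in>S. A (label_indicator S \<psi> (\<phi> n)) n + R (\<phi> n) n) + (\<Sum>n\<in>S. R (\<psi> n) n)"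

text \<open>
  Summing over sites the response at the label that \<open>\<phi>\<close> selects there is the same as pairing the
  indicators label by label; in the latter form self-adjointness applies.
\<close>

lemma sum_response_eq_sum_inner:
  assumes "finite S" "\<phi> \<in> S \<rightarrow> {1..M}"
  shows "(\<Sum>n\<in>S. A (label_indicator S \<psi> (\<phi> n)) n) =
    (\<Sum>m=1..M. ell_inner S (label_indicator S \<phi> m) (A (label_indicator S \<psi> m)))"
proof -
  have "(\<Sum>m=1..M. ell_inner S (label_indicator S \<phi> m) (A (label_indicator S \<psi> m))) =
      (\<Sum>n\<in>S. \<Sum>m=1..M. label_indicator S \<phi> m n * A (label_indicator S \<psi> m) n)"
    unfolding ell_inner_def by (rule sum.swap)
  also have "\<dots> = (\<Sum>n\<in>S. A (label_indicator S \<psi> (\<phi> n)) n)"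
  proof (rule sum.cong)
    fix n assume n: "n \<in> S"
    have "(\<Sum>m=1..M. label_indicator S \<phi> m n * A (label_indicator S \<psi> m) n) =
        (\<Sum>m=1..M. if \<phi> n = m then A (label_indicator S \<psi> m) n else 0)"
      using n by (intro sum.cong) (auto simp: label_indicator_def)
    also have "\<dots> = A (label_indicator S \<psi> (\<phi> n)) n"
      using n assms(2) by (auto simp: Pi_iff)
    finally show "(\<Sum>m=1..M. label_indicator S \<phi> m n * A (label_indicator S \<psi> m) n) =
        A (label_indicator S \<psi> (\<phi> n)) n" .
  qed simp
  finally show ?thesis
    by simp
qed

lemma energy_commute:
  assumes "finite S" "self_adjoint S A" "\<phi> \<in> S \<rightarrow> {1..M}" "\<psi> \<in> S \<rightarrow> {1..M}"
  shows "energy S A R \<phi> \<psi> = energy S A R \<psi> \<phi>"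
proof -
  have ind: "label_indicator S \<chi> m \<in> ell S" for \<chi> m
    by (simp add: label_indicator_def ell_def)
  have "ell_inner S (label_indicator S \<phi> m) (A (label_indicator S \<psi> m)) =
      ell_inner S (label_indicator S \<psi> m) (A (label_indicator S \<phi> m))" for m
  proof -
    have "ell_inner S (label_indicator S \<phi> m) (A (label_indicator S \<psi> m)) =
        ell_inner S (A (label_indicator S \<phi> m)) (label_indicator S \<psi> m)"
      using assms(2) ind unfolding self_adjoint_def by simp
    then show ?thesis
      by (simp add: ell_inner_def mult.commute)
  qed
  then have "(\<Sum>n\<in>S. A (label_indicator S \<psi> (\<phi> n)) n) = (\<Sum>n\<in>S. A (label_indicator S \<phi> (\<psi> n)) n)"
    using sum_response_eq_sum_inner[OF assms(1,3)] sum_response_eq_sum_inner[OF assms(1,4)]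
    by simp
  then show ?thesis
    by (simp add: energy_def sum.distrib)
qed

section \<open>The update as the least maximizer of the energy\<close>

lemma Min_argmax_set:
  fixes g :: "'b::linorder \<Rightarrow> real"
  assumes "finite B" "B \<noteq> {}"
  shows "Min (argmax_set g B) \<in> B"
    and "m \<in> B \<Longrightarrow> g m \<le> g (Min (argmax_set g B))"
    and "m \<in> B \<Longrightarrow> g m = g (Min (argmax_set g B)) \<Longrightarrow> Min (argmax_set g B) \<le> m"
proof -
  have eq: "argmax_set g B = {m \<in> B. \<forall>k\<in>B. g k \<le> g m}"
    by (auto simp: argmax_set_def is_arg_max_def not_less)
  have fin: "finite (argmax_set g B)"
    using assms(1) by (simp add: eq)
  have "Max (g ` B) \<in> g ` B"
    using assms by (intro Max_in) auto
  then obtain k where "k \<in> B" "g k = Max (g ` B)"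
    by force
  then have "k \<in> argmax_set g B"
    using assms(1) by (simp add: eq)
  with fin have "Min (argmax_set g B) \<in> argmax_set g B"
    by (intro Min_in) auto
  then show "Min (argmax_set g B) \<in> B"
    and max: "\<And>m. m \<in> B \<Longrightarrow> g m \<le> g (Min (argmax_set g B))"
    unfolding eq by blast+
  show "Min (argmax_set g B) \<le> m" if "m \<in> B" "g m = g (Min (argmax_set g B))"
    using that max fin by (intro Min_le) (auto simp: eq)
qed

lemma update_in_labelings:
  assumes "M \<ge> 1"
  shows "update S M A R \<psi> \<in> S \<rightarrow>\<^sub>E {1..M}"
proof -
  have "Min (argmax_set g {1..M}) \<in> {1..M}" for g
    using assms by (intro Min_argmax_set(1)) auto
  then show ?thesis
    unfolding update_def by (intro restrict_PiE_iff[THEN iffD2] ballI)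
qed

lemma site_energy_le_update:
  assumes "M \<ge> 1" "n \<in> S" "m \<in> {1..M}"
  shows "A (label_indicator S \<psi> m) n + R m n \<le>
    A (label_indicator S \<psi> (update S M A R \<psi> n)) n + R (update S M A R \<psi> n) n"
  using assms Min_argmax_set(2)[of "{1..M}" m "\<lambda>m. A (label_indicator S \<psi> m) n + R m n"]
  by (simp add: update_def)

lemma energy_le_energy_update:
  assumes "M \<ge> 1" "\<phi> \<in> S \<rightarrow> {1..M}"
  shows "energy S A R \<phi> \<psi> \<le> energy S A R (update S M A R \<psi>) \<psi>"
  unfolding energy_def using assms
  by (intro add_right_mono sum_mono site_energy_le_update) auto

text \<open>
  A sum of terms each bounded by its maximum attains the total maximum only if every term does, so
  a competing maximizer of the energy is a maximizer at every site, where the update takes the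
  smallest one. The order on labelings is the pointwise one; off \<open>S\<close> both labelings take the
  default value \<open>undefined\<close>.
\<close>

lemma update_le_if_energy_eq:
  assumes "finite S" "M \<ge> 1" "\<phi> \<in> S \<rightarrow>\<^sub>E {1..M}"
    and eq: "energy S A R \<phi> \<psi> = energy S A R (update S M A R \<psi>) \<psi>"
  shows "update S M A R \<psi> \<le> \<phi>"
proof (rule le_funI)
  fix n
  show "update S M A R \<psi> n \<le> \<phi> n"
  proof (cases "n \<in> S")
    case True
    let ?w = "\<lambda>n m. A (label_indicator S \<psi> m) n + R m n"
    have "?w n (\<phi> n) = ?w n (update S M A R \<psi> n)"
    proof (rule sum_mono_inv[where I = S])
      show "(\<Sum>n\<in>S. ?w n (\<phi> n)) = (\<Sum>n\<in>S. ?w n (update S M A R \<psi> n))"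
        using eq by (simp add: energy_def)
      show "?w k (\<phi> k) \<le> ?w k (update S M A R \<psi> k)" if "k \<in> S" for k
        using that assms(2,3) by (intro site_energy_le_update) auto
    qed (use True assms(1) in auto)
    moreover have "\<phi> n \<in> {1..M}"
      using True assms(3) by auto
    ultimately show ?thesis
      using True assms(2) Min_argmax_set(3)[of "{1..M}" "\<phi> n" "?w n"] by (simp add: update_def)
  next
    case False
    then show ?thesis
      by (simp add: update_def PiE_arb[OF assms(3) False])
  qed
qed

lemma finite_torus:
  assumes "\<And>d. d \<in> {1..D} \<Longrightarrow> N d \<ge> 1"
  shows "finite (torus D N)"
proof -
  have "finite (carrier (integer_mod_group (N d)))" if "d \<in> {1..D}" for d
    using assms[OF that] by (simp add: carrier_integer_mod_group)
  then show ?thesis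
    unfolding torus_def carrier_product_group by (intro finite_PiE) auto
qed

section \<open>Cycle lengths\<close>

theorem theorem2p1:
  fixes D M :: nat and N :: "nat \<Rightarrow> nat"
    and \<Omega> :: "(nat \<Rightarrow> int) set"
    and R :: "nat \<Rightarrow> (nat \<Rightarrow> int) \<Rightarrow> real"
    and A :: "((nat \<Rightarrow> int) \<Rightarrow> real) \<Rightarrow> ((nat \<Rightarrow> int) \<Rightarrow> real)"
    and \<psi>0 :: "(nat \<Rightarrow> int) \<Rightarrow> nat"
  assumes "D \<ge> 1" and "\<And>d. d \<in> {1..D} \<Longrightarrow> N d \<ge> 1" and "M \<ge> 1"
    and "\<Omega> = torus D N"
    and "\<And>m. m \<in> {1..M} \<Longrightarrow> R m \<in> ell \<Omega>"
    and "linear_operator \<Omega> A"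
    and "self_adjoint \<Omega> A"
    and "\<psi>0 \<in> \<Omega> \<rightarrow>\<^sub>E {1..M}"
  shows "cycle_length (iteration \<Omega> M A R \<psi>0) \<in> {1, 2}"
proof -
  let ?X = "\<Omega> \<rightarrow>\<^sub>E {1..M}"
  let ?f = "update \<Omega> M A R"
  have fin: "finite \<Omega>"
    using finite_torus assms(2,4) by blast
  have two_periodic: "(?f ^^ 2) \<psi> = \<psi>" if "\<psi> \<in> ?X" "p > 0" "(?f ^^ p) \<psi> = \<psi>" for \<psi> p
  proof -
    have "?f (?f \<psi>) = \<psi>"
    proof (rule periodic_point_of_symmetric_ascent[where X = ?X and J = "energy \<Omega> A R"])
      show "energy \<Omega> A R \<phi> \<chi> = energy \<Omega> A R \<chi> \<phi>" if "\<phi> \<in> ?X" "\<chi> \<in> ?X" for \<phi> \<chi>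
        using that fin assms(7) by (intro energy_commute[where M = M]) (auto simp: PiE_def)
      show "energy \<Omega> A R \<phi> \<chi> \<le> energy \<Omega> A R (?f \<chi>) \<chi>" if "\<phi> \<in> ?X" for \<phi> \<chi>
        using that assms(3) by (intro energy_le_energy_update) (auto simp: PiE_def)
      show "?f \<phi> \<in> ?X" for \<phi>
        using assms(3) by (rule update_in_labelings)
      show "?f \<chi> \<le> \<phi>"
        if "\<phi> \<in> ?X" "energy \<Omega> A R \<phi> \<chi> = energy \<Omega> A R (?f \<chi>) \<chi>" for \<phi> \<chi>
        using fin assms(3) that by (rule update_le_if_energy_eq)
    qed (fact that)+
    then show ?thesis
      by (simp add: numeral_2_eq_2)
  qed
  have "cycle_length (\<lambda>i. (?f ^^ i) \<psi>0) \<in> {1..2}"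
  proof (rule cycle_length_funpow_le[where X = ?X])
    show "finite ?X"
      using fin by (intro finite_PiE) auto
    show "?f \<phi> \<in> ?X" for \<phi>
      using assms(3) by (rule update_in_labelings)
    show "(?f ^^ 2) \<psi> = \<psi>" if "\<psi> \<in> ?X" "p > 0" "(?f ^^ p) \<psi> = \<psi>" for \<psi> p
      using that by (rule two_periodic)
  qed (use assms(8) in auto)
  then show ?thesis
    unfolding iteration_def[abs_def] by auto
qed

end
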